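(* Let $S$ be an infinite set, let $(R_k)_{k\in S}$ be a family of local commutative rings, and let $R=\prod_{k\in S}R_k$. Then the set of maximal wild primes of $R$ has cardinality $2^{2^{|S|}}$.
   Context: All rings are commutative with identity; a local ring is a ring with exactly one maximal ideal (no Noetherian hypothesis). For $k\in S$, $\pi_k:R\to R_k$ denotes the projection map. A tame prime of $R=\prod_{k\in S}R_k$ is a prime ideal of $R$ of the form $\pi_k^{-1}(\mathfrak p)$ for some $k\in S$ and some prime ideal $\mathfrak p$ of $R_k$. A wild prime of $R$ is a prime ideal of $R$ which is not tame. A maximal wild prime of $R$ is a wild prime of $R$ which is also a maximal ideal of $R$. *)

theory Defs
  imports "HOL-Algebra.Algebra" "HOL-Library.Equipollence"
begin

definition local_ring :: "('a, 'b) ring_scheme \<Rightarrow> bool"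
  where "local_ring R \<longleftrightarrow> cring R \<and> (\<exists>!M. maximalideal M R)"

(* The ring analogue of product_group: elements are extensional functions on S. *)
definition product_ring :: "'i set \<Rightarrow> ('i \<Rightarrow> ('a, 'b) ring_scheme) \<Rightarrow> ('i \<Rightarrow> 'a) ring"
  where "product_ring S R =
    \<lparr>carrier = (\<Pi>\<^sub>E k\<in>S. carrier (R k)),
     monoid.mult = (\<lambda>x y. \<lambda>k\<in>S. x k \<otimes>\<^bsub>R k\<^esub> y k),
     one = (\<lambda>k\<in>S. \<one>\<^bsub>R k\<^esub>),
     ring.zero = (\<lambda>k\<in>S. \<zero>\<^bsub>R k\<^esub>),
     ring.add = (\<lambda>x y. \<lambda>k\<in>S. x k \<oplus>\<^bsub>R k\<^esub> y k)\<rparr>"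

definition tame_prime :: "'i set \<Rightarrow> ('i \<Rightarrow> ('a, 'b) ring_scheme) \<Rightarrow> ('i \<Rightarrow> 'a) set \<Rightarrow> bool"
  where "tame_prime S R P \<longleftrightarrow> primeideal P (product_ring S R) \<and>
    (\<exists>k\<in>S. \<exists>p. primeideal p (R k) \<and> P = {x \<in> carrier (product_ring S R). x k \<in> p})"

definition wild_prime :: "'i set \<Rightarrow> ('i \<Rightarrow> ('a, 'b) ring_scheme) \<Rightarrow> ('i \<Rightarrow> 'a) set \<Rightarrow> bool"
  where "wild_prime S R P \<longleftrightarrow> primeideal P (product_ring S R) \<and> \<not> tame_prime S R P"

definition maximal_wild_prime :: "'i set \<Rightarrow> ('i \<Rightarrow> ('a, 'b) ring_scheme) \<Rightarrow> ('i \<Rightarrow> 'a) set \<Rightarrow> bool"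
  where "maximal_wild_prime S R P \<longleftrightarrow> wild_prime S R P \<and> maximalideal P (product_ring S R)"

lemma product_ring_simps [simp]:
  "carrier (product_ring S R) = (\<Pi>\<^sub>E k\<in>S. carrier (R k))"
  "x \<otimes>\<^bsub>product_ring S R\<^esub> y = (\<lambda>k\<in>S. x k \<otimes>\<^bsub>R k\<^esub> y k)"
  "\<one>\<^bsub>product_ring S R\<^esub> = (\<lambda>k\<in>S. \<one>\<^bsub>R k\<^esub>)"
  "\<zero>\<^bsub>product_ring S R\<^esub> = (\<lambda>k\<in>S. \<zero>\<^bsub>R k\<^esub>)"
  "x \<oplus>\<^bsub>product_ring S R\<^esub> y = (\<lambda>k\<in>S. x k \<oplus>\<^bsub>R k\<^esub> y k)"
  by (simp_all add: product_ring_def)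

lemma cring_product_ring:
  assumes "\<And>k. k \<in> S \<Longrightarrow> cring (R k)"
  shows "cring (product_ring S R)"
proof (rule cringI)
  have ring: "ring (R k)" if "k \<in> S" for k
    using assms[OF that] by (rule cring.axioms)
  show "abelian_group (product_ring S R)"
  proof (rule abelian_groupI, goal_cases)
    case (6 x)
    then have "(\<lambda>k\<in>S. \<ominus>\<^bsub>R k\<^esub> x k) \<in> carrier (product_ring S R)"
      using ring by (auto simp: PiE_iff abelian_group.a_inv_closed ring.is_abelian_group)
    moreover have "(\<lambda>k\<in>S. \<ominus>\<^bsub>R k\<^esub> x k) \<oplus>\<^bsub>product_ring S R\<^esub> x = \<zero>\<^bsub>product_ring S R\<^esub>"
      using 6 ring by (auto simp: PiE_iff abelian_group.l_neg ring.is_abelian_group intro!: restrict_ext)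
    ultimately show ?case by blast
  qed (use ring in \<open>auto simp: PiE_iff ring.ring_simprules extensional_def fun_eq_iff\<close>)
  show "comm_monoid (product_ring S R)"
    by (rule comm_monoidI)
      (use assms ring in \<open>auto simp: PiE_iff cring.cring_simprules monoid.r_one ring.is_monoid extensional_def fun_eq_iff\<close>)
  show "(x \<oplus>\<^bsub>product_ring S R\<^esub> y) \<otimes>\<^bsub>product_ring S R\<^esub> z =
      x \<otimes>\<^bsub>product_ring S R\<^esub> z \<oplus>\<^bsub>product_ring S R\<^esub> y \<otimes>\<^bsub>product_ring S R\<^esub> z"
    if "x \<in> carrier (product_ring S R)" "y \<in> carrier (product_ring S R)"
      "z \<in> carrier (product_ring S R)" for x y z
    using that ring by (auto simp: PiE_iff ring.ring_simprules intro!: restrict_ext)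
qed

end

theory Submission
  imports Defs
begin

(* A maximal ideal is determined by the idempotents (indicators of subsets of S) that it contains, so
  there are at most 2^2^|S| of them.  Indeed, if x \<in> P - Q with Q maximal, then 1 = q + r x with
  q \<in> Q; as each factor is local, q k or (r x) k is a unit for every k.  Let A be the set of k for
  which (r x) k is a unit.  Then the indicator of A lies in P and that of S - A in Q.  If P and Q
  contained the same idempotents, both indicators, hence their sum 1, would lie in Q.
  Conversely, Hausdorff's independent family (A Y) of 2^|S| subsets of S yields for each
  T \<subseteq> Pow S a proper ideal containing the indicators of all singletons, of S - A Y for
  Y \<in> T, and of A Y for Y \<notin> T.  Maximal ideals above these are wild because of the
  singletons, and they are pairwise distinct. *)

section \<open>Maximal ideals and local rings\<close>

text \<open>Zorn's lemma applies to the ideals above \<open>I\<close> that avoid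
  \<open>\<one>\<close>: the union of a nonempty chain of them avoids it too. Any strictly larger
  ideal than a maximal one among them contains \<open>\<one>\<close> and hence is the whole
  ring.\<close>

lemma (in cring) exists_maximalideal_superset:
  assumes "ideal I R" "\<one> \<notin> I"
  shows "\<exists>M. maximalideal M R \<and> I \<subseteq> M"
proof -
  let ?AA = "{J. ideal J R \<and> I \<subseteq> J \<and> \<one> \<notin> J}"
  have "\<exists>M\<in>?AA. \<forall>T\<in>?AA. M \<subseteq> T \<longrightarrow> T = M"
  proof (rule subset_Zorn_nonempty)
    show "?AA \<noteq> {}" using assms by blast
  next
    fix C assume C: "C \<noteq> {}" "subset.chain ?AA C"
    then have "subset.chain {J. ideal J R} C"
      unfolding subset_chain_def by auto
    then have "ideal (\<Union>C) R"
      using chain_Union_is_ideal[of C] C(1) by simp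
    then show "\<Union>C \<in> ?AA"
      using C unfolding subset_chain_def by blast
  qed
  then obtain M where M: "ideal M R" "I \<subseteq> M" "\<one> \<notin> M"
    and max: "\<And>J. \<lbrakk>ideal J R; \<one> \<notin> J; M \<subseteq> J\<rbrakk> \<Longrightarrow> J = M"
    by (smt (verit) mem_Collect_eq subset_trans)
  have "maximalideal M R"
    using M max ideal.one_imp_carrier by (intro maximalidealI) auto
  with M show ?thesis by blast
qed

text \<open>A non-unit generates a proper ideal and so lies in some maximal ideal. By uniqueness,
  two non-units \<open>a\<close> and \<open>b\<close> lie in the same one, which would then contain
  their sum \<open>\<one>\<close>.\<close>

lemma local_ring_add_eq_one:
  fixes R (structure)
  assumes "local_ring R" "a \<in> carrier R" "b \<in> carrier R" "a \<oplus>\<^bsub>R\<^esub> b = \<one>\<^bsub>R\<^esub>"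
  shows "a \<in> Units R \<or> b \<in> Units R"
proof (rule ccontr)
  assume contra: "\<not> ?thesis"
  interpret cring R using assms(1) by (simp add: local_ring_def)
  have *: "\<exists>M. maximalideal M R \<and> x \<in> M" if "x \<in> carrier R" "x \<notin> Units R" for x
  proof -
    have "\<one> \<notin> PIdl x"
      using that by (auto simp: cgenideal_def Units_def m_comm)
    then show ?thesis
      using exists_maximalideal_superset[OF cgenideal_ideal] cgenideal_self that by blast
  qed
  obtain M where M: "maximalideal M R" "a \<in> M" "b \<in> M"
    using *[of a] *[of b] contra assms unfolding local_ring_def by metis
  then interpret maximalideal M R by blast
  show False
    using M(2,3) a_closed assms(4) one_imp_carrier I_notcarr by metis
qed

section \<open>Idempotents of the product ring\<close>

definition idem :: "'i set \<Rightarrow> ('i \<Rightarrow> ('a, 'b) ring_scheme) \<Rightarrow> 'i set \<Rightarrow> 'i \<Rightarrow> 'a"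
  where "idem S R A = (\<lambda>k\<in>S. if k \<in> A then \<one>\<^bsub>R k\<^esub> else \<zero>\<^bsub>R k\<^esub>)"

locale ring_family =
  fixes S :: "'i set" and R :: "'i \<Rightarrow> ('a, 'b) ring_scheme"
  assumes cring: "k \<in> S \<Longrightarrow> cring (R k)"
begin

sublocale prod: cring "product_ring S R"
  by (rule cring_product_ring[OF cring])

lemma factor_ring: "k \<in> S \<Longrightarrow> ring (R k)"
  using cring by (rule cring.axioms)

lemma idem_closed: "idem S R A \<in> carrier (product_ring S R)"
  using factor_ring by (auto simp: idem_def ring.ring_simprules)

lemma idem_add_compl: "idem S R A \<oplus>\<^bsub>product_ring S R\<^esub> idem S R (S - A) = \<one>\<^bsub>product_ring S R\<^esub>"
  using factor_ring by (auto simp: idem_def ring.ring_simprules fun_eq_iff)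

text \<open>Multiplying \<open>x\<close> by the element that inverts it on \<open>A\<close> and
  vanishes elsewhere leaves the indicator of \<open>A\<close>.\<close>

lemma idem_in_ideal:
  assumes "ideal P (product_ring S R)" "x \<in> P" "\<And>k. k \<in> A \<Longrightarrow> k \<in> S \<Longrightarrow> x k \<in> Units (R k)"
  shows "idem S R A \<in> P"
proof -
  interpret ideal P "product_ring S R" by fact
  have x: "x \<in> carrier (product_ring S R)" using assms(2) Icarr by blast
  define y where "y = (\<lambda>k\<in>S. if k \<in> A then inv\<^bsub>R k\<^esub> x k else \<zero>\<^bsub>R k\<^esub>)"
  have y: "y \<in> carrier (product_ring S R)"
    using factor_ring assms(3)
    by (auto simp: y_def ring.ring_simprules monoid.Units_inv_closed ring.is_monoid)
  have "y \<otimes>\<^bsub>product_ring S R\<^esub> x = idem S R A"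
    using x factor_ring assms(3)
    by (auto simp: y_def idem_def fun_eq_iff PiE_iff ring.ring_simprules monoid.Units_l_inv ring.is_monoid)
  then show ?thesis
    using I_l_closed[OF assms(2) y] by simp
qed

text \<open>The elements whose support is covered by finitely many members of \<open>G\<close> form
  an ideal containing the required indicators. It is proper: by \<open>nz\<close> the support of
  \<open>\<one>\<close> is \<open>S\<close>, which \<open>nocover\<close> keeps from being
  covered.\<close>

lemma exists_maximalideal_idem:
  assumes nz: "\<And>k. k \<in> S \<Longrightarrow> \<one>\<^bsub>R k\<^esub> \<noteq> \<zero>\<^bsub>R k\<^esub>"
    and nocover: "\<And>F. \<lbrakk>finite F; F \<subseteq> G\<rbrakk> \<Longrightarrow> \<not> S \<subseteq> \<Union>F"
  shows "\<exists>M. maximalideal M (product_ring S R) \<and> (\<forall>A\<in>G. idem S R A \<in> M)"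
proof -
  define supp where "supp x = {k \<in> S. x k \<noteq> \<zero>\<^bsub>R k\<^esub>}" for x
  define J where "J = {x \<in> carrier (product_ring S R). \<exists>F. finite F \<and> F \<subseteq> G \<and> supp x \<subseteq> \<Union>F}"
  have J_carr: "x \<in> carrier (product_ring S R)" if "x \<in> J" for x
    using that unfolding J_def by blast
  have J_E: "\<exists>F. finite F \<and> F \<subseteq> G \<and> supp x \<subseteq> \<Union>F" if "x \<in> J" for x
    using that unfolding J_def by blast
  have J_I: "x \<in> J" if "x \<in> carrier (product_ring S R)" "finite F" "F \<subseteq> G" "supp x \<subseteq> \<Union>F" for x F
    using that unfolding J_def by blast
  have mult: "x \<otimes>\<^bsub>product_ring S R\<^esub> a \<in> J"
    if aJ: "a \<in> J" and x: "x \<in> carrier (product_ring S R)" for a x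
  proof -
    have a: "a \<in> carrier (product_ring S R)" using J_carr aJ .
    obtain F where F: "finite F" "F \<subseteq> G" "supp a \<subseteq> \<Union>F"
      using J_E[OF aJ] by blast
    have "supp (x \<otimes>\<^bsub>product_ring S R\<^esub> a) \<subseteq> supp a"
      using x factor_ring by (auto simp: supp_def PiE_iff ring.ring_simprules)
    then show ?thesis
      using F by (intro J_I[OF prod.m_closed[OF x a]]) auto
  qed
  have "ideal J (product_ring S R)"
  proof (rule idealI)
    show "ring (product_ring S R)" by (rule prod.ring_axioms)
    show "subgroup J (add_monoid (product_ring S R))"
    proof (rule group.subgroupI)
      show "group (add_monoid (product_ring S R))" by (rule prod.a_group)
      show "J \<subseteq> carrier (add_monoid (product_ring S R))" using J_carr by auto
      have "\<zero>\<^bsub>product_ring S R\<^esub> \<in> J"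
        by (rule J_I[OF prod.zero_closed, of "{}"]) (auto simp: supp_def)
      then show "J \<noteq> {}" by blast
    next
      fix a assume a: "a \<in> J"
      then have ac: "a \<in> carrier (product_ring S R)" by (rule J_carr)
      \<comment> \<open>An additive inverse is a multiple by -1, so \<open>mult\<close> already
        gives closure under it.\<close>
      have "(\<ominus>\<^bsub>product_ring S R\<^esub> \<one>\<^bsub>product_ring S R\<^esub>) \<otimes>\<^bsub>product_ring S R\<^esub> a = \<ominus>\<^bsub>product_ring S R\<^esub> a"
        using prod.l_minus[OF prod.one_closed ac] prod.l_one[OF ac] by metis
      then show "inv\<^bsub>add_monoid (product_ring S R)\<^esub> a \<in> J"
        using mult[OF a prod.a_inv_closed[OF prod.one_closed]] by (metis a_inv_def)
    next
      fix a b assume ab: "a \<in> J" "b \<in> J"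
      then have c: "a \<in> carrier (product_ring S R)" "b \<in> carrier (product_ring S R)"
        by (simp_all only: J_carr)
      obtain F F' where F: "finite F" "F \<subseteq> G" "supp a \<subseteq> \<Union>F"
        "finite F'" "F' \<subseteq> G" "supp b \<subseteq> \<Union>F'"
        using J_E[OF ab(1)] J_E[OF ab(2)] by blast
      have "supp (a \<oplus>\<^bsub>product_ring S R\<^esub> b) \<subseteq> supp a \<union> supp b"
        using factor_ring by (auto simp: supp_def ring.ring_simprules)
      then have "supp (a \<oplus>\<^bsub>product_ring S R\<^esub> b) \<subseteq> \<Union>(F \<union> F')"
        using F by blast
      then have "a \<oplus>\<^bsub>product_ring S R\<^esub> b \<in> J"
        using F by (intro J_I[OF prod.a_closed[OF c], of "F \<union> F'"]) auto
      then show "a \<otimes>\<^bsub>add_monoid (product_ring S R)\<^esub> b \<in> J" by simp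
    qed
    show "x \<otimes>\<^bsub>product_ring S R\<^esub> a \<in> J"
      if "a \<in> J" "x \<in> carrier (product_ring S R)" for a x
      using mult that .
    show "a \<otimes>\<^bsub>product_ring S R\<^esub> x \<in> J"
      if "a \<in> J" "x \<in> carrier (product_ring S R)" for a x
    proof -
      have "a \<in> carrier (product_ring S R)" using J_carr that(1) .
      then show ?thesis using mult[OF that] prod.m_comm that(2) by metis
    qed
  qed
  moreover have "\<one>\<^bsub>product_ring S R\<^esub> \<notin> J"
  proof
    assume one: "\<one>\<^bsub>product_ring S R\<^esub> \<in> J"
    obtain F where "finite F" "F \<subseteq> G" "supp \<one>\<^bsub>product_ring S R\<^esub> \<subseteq> \<Union>F"
      using J_E[OF one] by blast
    moreover have "supp \<one>\<^bsub>product_ring S R\<^esub> = S"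
      using nz by (auto simp: supp_def)
    ultimately show False using nocover by simp
  qed
  moreover have "idem S R A \<in> J" if "A \<in> G" for A
    using that
    by (intro J_I[OF idem_closed, of "{A}"]) (auto simp: supp_def idem_def split: if_splits)
  ultimately show ?thesis
    using prod.exists_maximalideal_superset[of J] by blast
qed

end

locale local_ring_family =
  fixes S :: "'i set" and R :: "'i \<Rightarrow> ('a, 'b) ring_scheme"
  assumes local_ring: "k \<in> S \<Longrightarrow> local_ring (R k)"
begin

sublocale ring_family S R
  using local_ring by (intro ring_family.intro) (simp add: local_ring_def)

lemma one_neq_zero:
  assumes "k \<in> S"
  shows "\<one>\<^bsub>R k\<^esub> \<noteq> \<zero>\<^bsub>R k\<^esub>"
proof
  assume eq: "\<one>\<^bsub>R k\<^esub> = \<zero>\<^bsub>R k\<^esub>"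
  obtain M where "maximalideal M (R k)"
    using local_ring[OF assms] by (auto simp: local_ring_def)
  then interpret maximalideal M "R k" .
  show False using eq one_imp_carrier zero_closed I_notcarr by auto
qed

text \<open>This is half of the injectivity argument: for two maximal ideals with the same
  idempotents it applies in both directions.\<close>

lemma maximalideal_subset_if_idem_eq:
  assumes P: "ideal P (product_ring S R)" and Q: "maximalideal Q (product_ring S R)"
    and eq: "\<And>A. A \<subseteq> S \<Longrightarrow> idem S R A \<in> P \<Longrightarrow> idem S R A \<in> Q"
  shows "P \<subseteq> Q"
proof
  fix x assume xP: "x \<in> P"
  interpret P: ideal P "product_ring S R" by fact
  interpret Q: maximalideal Q "product_ring S R" by fact
  have x: "x \<in> carrier (product_ring S R)" using xP P.Icarr by blast
  show "x \<in> Q"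
  proof (rule ccontr)
    assume xQ: "x \<notin> Q"
    \<comment> \<open>\<open>Q\<close> together with \<open>x\<close> generates an ideal strictly
      above \<open>Q\<close>, hence the whole ring; writing \<open>\<one>\<close> in it yields
      \<open>q\<close> and \<open>r\<close>.\<close>
    let ?J = "Q <+>\<^bsub>product_ring S R\<^esub> (PIdl\<^bsub>product_ring S R\<^esub> x)"
    have J: "ideal ?J (product_ring S R)"
      using prod.add_ideals[OF Q.is_ideal prod.cgenideal_ideal[OF x]] .
    have "q \<in> ?J" if "q \<in> Q" for q
    proof -
      have "q = q \<oplus>\<^bsub>product_ring S R\<^esub> \<zero>\<^bsub>product_ring S R\<^esub>"
        using prod.r_zero[OF Q.Icarr[OF that]] by metis
      moreover have "\<zero>\<^bsub>product_ring S R\<^esub> \<in> PIdl\<^bsub>product_ring S R\<^esub> x"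
        using additive_subgroup.zero_closed[OF ideal.axioms(1)[OF prod.cgenideal_ideal[OF x]]] .
      ultimately show ?thesis using that unfolding set_add_def' by blast
    qed
    moreover have "x \<in> ?J"
    proof -
      have "x = \<zero>\<^bsub>product_ring S R\<^esub> \<oplus>\<^bsub>product_ring S R\<^esub> x"
        using prod.l_zero[OF x] by metis
      then show ?thesis
        using Q.zero_closed prod.cgenideal_self[OF x] unfolding set_add_def' by blast
    qed
    moreover have "?J \<subseteq> carrier (product_ring S R)"
      using ideal.Icarr[OF J] by blast
    ultimately have "?J = carrier (product_ring S R)"
      using Q.I_maximal[OF J] xQ by blast
    then have "\<one>\<^bsub>product_ring S R\<^esub> \<in> ?J"
      using prod.one_closed by blast
    then obtain q r where q: "q \<in> Q" and r: "r \<in> carrier (product_ring S R)"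
      and one: "\<one>\<^bsub>product_ring S R\<^esub> = q \<oplus>\<^bsub>product_ring S R\<^esub> (r \<otimes>\<^bsub>product_ring S R\<^esub> x)"
      unfolding set_add_def' cgenideal_def by blast
    define y where "y = r \<otimes>\<^bsub>product_ring S R\<^esub> x"
    have y: "y \<in> P" unfolding y_def using P.I_l_closed[OF xP r] .
    \<comment> \<open>On \<open>A\<close> the element \<open>y\<close> of \<open>P\<close> is
      invertible; off \<open>A\<close>, locality makes \<open>q\<close> invertible. So the indicator
      of \<open>A\<close> reaches \<open>Q\<close> through \<open>P\<close>, and that of
      \<open>S - A\<close> through \<open>q\<close>.\<close>
    define A where "A = {k \<in> S. y k \<in> Units (R k)}"
    have "idem S R A \<in> P"
      by (rule idem_in_ideal[OF P y]) (simp add: A_def)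
    then have 1: "idem S R A \<in> Q" using eq by (simp add: A_def)
    have unit: "q k \<in> Units (R k)" if "k \<in> S - A" for k
    proof -
      have k: "k \<in> S" using that by blast
      have "(q \<oplus>\<^bsub>product_ring S R\<^esub> y) k = \<one>\<^bsub>product_ring S R\<^esub> k"
        using one unfolding y_def by metis
      then have "q k \<oplus>\<^bsub>R k\<^esub> y k = \<one>\<^bsub>R k\<^esub>"
        using k by simp
      moreover have "q k \<in> carrier (R k)" "y k \<in> carrier (R k)"
        using Q.Icarr[OF q] P.Icarr[OF y] k by auto
      ultimately show ?thesis
        using local_ring_add_eq_one[OF local_ring[OF k]] that by (auto simp: A_def)
    qed
    have "idem S R (S - A) \<in> Q"
      by (rule idem_in_ideal[OF Q.is_ideal q unit])
    then have "\<one>\<^bsub>product_ring S R\<^esub> \<in> Q"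
      using Q.a_closed[OF 1] idem_add_compl by metis
    then show False using Q.one_imp_carrier Q.I_notcarr by blast
  qed
qed

lemma maximalideals_lepoll: "{P. maximalideal P (product_ring S R)} \<lesssim> Pow (Pow S)"
  unfolding lepoll_def
proof (intro exI conjI)
  let ?f = "\<lambda>P. {A \<in> Pow S. idem S R A \<in> P}"
  show "inj_on ?f {P. maximalideal P (product_ring S R)}"
  proof (rule inj_onI)
    fix P Q
    assume PQ: "P \<in> {P. maximalideal P (product_ring S R)}" "Q \<in> {P. maximalideal P (product_ring S R)}"
      and eq: "?f P = ?f Q"
    have iff: "idem S R A \<in> P \<longleftrightarrow> idem S R A \<in> Q" if "A \<subseteq> S" for A
      using eq that by blast
    have "maximalideal P (product_ring S R)" "maximalideal Q (product_ring S R)"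
      using PQ by simp_all
    then show "P = Q"
      using iff by (meson maximalideal_subset_if_idem_eq maximalideal.axioms(1) subset_antisym)
  qed
  show "?f ` {P. maximalideal P (product_ring S R)} \<subseteq> Pow (Pow S)" by blast
qed

text \<open>The indicator of \<open>{k}\<close> has value one at \<open>k\<close>, so a tame prime
  over \<open>k\<close> containing it would come from a prime of \<open>R k\<close> that contains
  one.\<close>

lemma maximal_wild_primeI:
  assumes M: "maximalideal M (product_ring S R)" and idem: "\<And>k. k \<in> S \<Longrightarrow> idem S R {k} \<in> M"
  shows "maximal_wild_prime S R M"
proof -
  have "\<not> tame_prime S R M"
  proof
    assume "tame_prime S R M"
    then obtain k p where k: "k \<in> S" and p: "primeideal p (R k)"
      and M_eq: "M = {x \<in> carrier (product_ring S R). x k \<in> p}"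
      by (auto simp: tame_prime_def)
    interpret primeideal p "R k" by fact
    have "idem S R {k} k \<in> p" using idem[OF k] M_eq by blast
    then have "\<one>\<^bsub>R k\<^esub> \<in> p" using k by (simp add: idem_def)
    then show False using one_imp_carrier I_notcarr by blast
  qed
  then show ?thesis
    using M prod.maximalideal_prime by (simp add: maximal_wild_prime_def wild_prime_def)
qed

end

section \<open>Independent families\<close>

text \<open>One distinguishing point for each of the finitely many pairs of distinct members
  suffices. Arbitrary subsets of \<open>S\<close> are thereby replaced by finite traces, which
  points of \<open>S\<close> can encode.\<close>

lemma finite_set_separating:
  assumes "finite W" "W \<subseteq> Pow S"
  shows "\<exists>F. finite F \<and> F \<subseteq> S \<and> inj_on (\<lambda>Y. F \<inter> Y) W"
proof -
  have ex: "\<exists>s. s \<in> S \<and> (s \<in> Y \<longleftrightarrow> s \<notin> Z)" if "Y \<in> W" "Z \<in> W" "Y \<noteq> Z" for Y Z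
    using that assms(2) by blast
  define d where "d Y Z = (SOME s. s \<in> S \<and> (s \<in> Y \<longleftrightarrow> s \<notin> Z))" for Y Z
  have d: "d Y Z \<in> S \<and> (d Y Z \<in> Y \<longleftrightarrow> d Y Z \<notin> Z)" if "Y \<in> W" "Z \<in> W" "Y \<noteq> Z" for Y Z
    unfolding d_def by (rule someI_ex[OF ex[OF that]])
  define F where "F = (\<lambda>(Y, Z). d Y Z) ` {(Y, Z) \<in> W \<times> W. Y \<noteq> Z}"
  have "finite {(Y, Z) \<in> W \<times> W. Y \<noteq> Z}"
    by (rule finite_subset[of _ "W \<times> W"]) (use assms(1) in auto)
  then have "finite F" unfolding F_def by (rule finite_imageI)
  moreover have "F \<subseteq> S" using d by (auto simp: F_def)
  moreover have "inj_on (\<lambda>Y. F \<inter> Y) W"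
  proof (rule inj_onI, rule ccontr)
    fix Y Z assume YZ: "Y \<in> W" "Z \<in> W" "F \<inter> Y = F \<inter> Z" "Y \<noteq> Z"
    then have "d Y Z \<in> F" unfolding F_def by force
    then show False using d YZ by blast
  qed
  ultimately show ?thesis by blast
qed

text \<open>The points of \<open>S\<close> encode pairs of a finite \<open>F \<subseteq> S\<close> and a finite family of finite sets;
  the member of the family attached to \<open>Y \<subseteq> S\<close> consists of the pairs whose family contains
  \<open>F \<inter> Y\<close>.\<close>

lemma exists_independent_family:
  fixes S :: "'i set"
  assumes "infinite S"
  shows "\<exists>A :: 'i set \<Rightarrow> 'i set. \<forall>W T K. finite W \<longrightarrow> W \<subseteq> Pow S \<longrightarrow> finite K \<longrightarrow>
    (\<exists>s\<in>S - K. \<forall>Y\<in>W. s \<in> A Y \<longleftrightarrow> Y \<in> T)"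
proof -
  \<comment> \<open>An infinite set is equipotent to its set of finite subsets and to its square, so
    \<open>g\<close> can use the points of \<open>S\<close> as codes.\<close>
  have "Fpow S \<approx> S" using assms by (rule eqpoll_Fpow)
  have "infinite (Fpow S)" using \<open>Fpow S \<approx> S\<close> assms eqpoll_finite_iff by blast
  then have "Fpow (Fpow S) \<approx> S" using \<open>Fpow S \<approx> S\<close> eqpoll_Fpow eqpoll_trans by blast
  then have "Fpow S \<times> Fpow (Fpow S) \<approx> S \<times> S"
    using \<open>Fpow S \<approx> S\<close> times_eqpoll_cong by blast
  also have "S \<times> S \<approx> S"
    using card_of_Times_same_infinite[OF assms] by (simp add: eqpoll_iff_card_of_ordIso)
  finally obtain g where g: "bij_betw g (Fpow S \<times> Fpow (Fpow S)) S"
    by (auto simp: eqpoll_def)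
  define A where "A Y = g ` {(F, C) \<in> Fpow S \<times> Fpow (Fpow S). F \<inter> Y \<in> C}" for Y
  have A: "g (F, C) \<in> A Y \<longleftrightarrow> F \<inter> Y \<in> C" if "F \<in> Fpow S" "C \<in> Fpow (Fpow S)" for F C Y
    using bij_betw_imp_inj_on[OF g] that unfolding A_def inj_on_def by auto
  have "\<exists>s\<in>S - K. \<forall>Y\<in>W. s \<in> A Y \<longleftrightarrow> Y \<in> T"
    if W: "finite W" "W \<subseteq> Pow S" and K: "finite K" for W T K
  proof -
    obtain F where F: "finite F" "F \<subseteq> S" "inj_on (\<lambda>Y. F \<inter> Y) W"
      using finite_set_separating[OF W] by blast
    \<comment> \<open>The family lists exactly the traces of the members of \<open>W\<close> that
      lie in \<open>T\<close>. The extra point \<open>a\<close> outside \<open>F\<close> varies the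
      code, giving infinitely many candidates, so one of them avoids \<open>K\<close>.\<close>
    define c where "c a = (insert a F, (\<lambda>Y. insert a F \<inter> Y) ` (W \<inter> T))" for a
    have c: "c a \<in> Fpow S \<times> Fpow (Fpow S)" if "a \<in> S" for a
      using that F W by (auto simp: c_def Fpow_def)
    have "inj_on c (S - F)"
      by (rule inj_onI) (auto simp: c_def)
    then have "inj_on (g \<circ> c) (S - F)"
      by (intro comp_inj_on) (auto intro!: inj_on_subset[OF bij_betw_imp_inj_on[OF g]] dest: c)
    moreover have "infinite (S - F)" using F assms by simp
    ultimately have "infinite ((g \<circ> c) ` (S - F))"
      using finite_image_iff by blast
    then obtain a where a: "a \<in> S - F" "g (c a) \<notin> K"
      using K by (metis (no_types, lifting) comp_apply finite_subset image_subsetI)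
    have "g (c a) \<in> A Y \<longleftrightarrow> Y \<in> T" if Y: "Y \<in> W" for Y
    proof -
      have "g (c a) \<in> A Y \<longleftrightarrow> insert a F \<inter> Y \<in> (\<lambda>Y. insert a F \<inter> Y) ` (W \<inter> T)"
        using A c[of a] a(1) unfolding c_def by auto
      also have "\<dots> \<longleftrightarrow> Y \<in> T"
      proof
        assume "insert a F \<inter> Y \<in> (\<lambda>Y. insert a F \<inter> Y) ` (W \<inter> T)"
        then obtain Z where Z: "Z \<in> W \<inter> T" "insert a F \<inter> Y = insert a F \<inter> Z" by blast
        \<comment> \<open>Equal traces on the larger set agree on \<open>F\<close>, which separates
          the members of \<open>W\<close>; hence \<open>Y = Z\<close>.\<close>
        then have "F \<inter> Y = F \<inter> Z" by blast
        then show "Y \<in> T" using F(3) Y Z(1) by (auto dest: inj_onD)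
      qed (use Y in blast)
      finally show ?thesis .
    qed
    moreover have "g (c a) \<in> S"
      using bij_betwE[OF g] c a(1) by blast
    ultimately show ?thesis using a(2) by blast
  qed
  then show ?thesis by blast
qed

section \<open>The number of maximal wild primes\<close>

lemma (in local_ring_family) Pow_Pow_lepoll_maximal_wild_primes:
  assumes "infinite S"
  shows "Pow (Pow S) \<lesssim> {P. maximal_wild_prime S R P}"
proof -
  obtain A :: "'i set \<Rightarrow> 'i set" where A: "\<And>W T K. \<lbrakk>finite W; W \<subseteq> Pow S; finite K\<rbrakk> \<Longrightarrow>
      \<exists>s\<in>S - K. \<forall>Y\<in>W. s \<in> A Y \<longleftrightarrow> Y \<in> T"
    using exists_independent_family[OF assms] by blast
  define h where "h T Y = (if Y \<in> T then S - A Y else A Y)" for T Y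
  \<comment> \<open>The sets \<open>h T Y\<close> make the ideal remember \<open>T\<close>; the
    singletons make it wild.\<close>
  define G where "G T = h T ` Pow S \<union> (\<lambda>k. {k}) ` S" for T
  have nocover: "\<not> S \<subseteq> \<Union>F" if F: "finite F" "F \<subseteq> G T" for F T
  proof -
    have "finite (F \<inter> h T ` Pow S)" "finite (F \<inter> (\<lambda>k. {k}) ` S)"
      using F by auto
    then obtain W K where W: "finite W" "W \<subseteq> Pow S" "F \<inter> h T ` Pow S = h T ` W"
      and K: "finite K" "F \<inter> (\<lambda>k. {k}) ` S = (\<lambda>k. {k}) ` K"
      using finite_subset_image[OF _ inf_le2] by metis
    obtain s where s: "s \<in> S - K" "\<forall>Y\<in>W. s \<in> A Y \<longleftrightarrow> Y \<in> T"
      using A[OF W(1,2) K(1)] by blast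
    have "F = (F \<inter> h T ` Pow S) \<union> (F \<inter> (\<lambda>k. {k}) ` S)"
      using F(2) unfolding G_def by blast
    then have "F = h T ` W \<union> (\<lambda>k. {k}) ` K"
      unfolding W(3) K(2) .
    \<comment> \<open>For \<open>Y\<close> in \<open>W\<close>, the point \<open>s\<close> lies in
      \<open>A Y\<close> exactly when \<open>h T Y\<close> is its complement, so \<open>s\<close>
      misses every \<open>h T Y\<close>; it misses the singletons because it is outside
      \<open>K\<close>.\<close>
    then have "s \<notin> \<Union>F" using s by (auto simp: h_def split: if_splits)
    then show ?thesis using s(1) by blast
  qed
  have "\<exists>M. maximalideal M (product_ring S R) \<and> (\<forall>B\<in>G T. idem S R B \<in> M)" for T
    using exists_maximalideal_idem[OF one_neq_zero nocover] .
  then obtain M where M: "\<And>T. maximalideal (M T) (product_ring S R)"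
    and idem: "\<And>T B. B \<in> G T \<Longrightarrow> idem S R B \<in> M T"
    by metis
  \<comment> \<open>A set \<open>Y\<close> in \<open>T\<close> but not in \<open>T'\<close> would
    put the indicators of \<open>S - A Y\<close> and of \<open>A Y\<close> into the same ideal, and
    they sum to \<open>\<one>\<close>.\<close>
  have sub: "T \<subseteq> T'" if "T \<subseteq> Pow S" "M T = M T'" for T T'
  proof (rule subsetI, rule ccontr)
    fix Y assume Y: "Y \<in> T" "Y \<notin> T'"
    interpret maximalideal "M T" "product_ring S R" by (rule M)
    have "idem S R (S - A Y) \<in> M T" "idem S R (A Y) \<in> M T"
      using Y that idem[of "h T Y" T] idem[of "h T' Y" T'] by (auto simp: h_def G_def)
    then have "\<one>\<^bsub>product_ring S R\<^esub> \<in> M T"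
      using a_closed idem_add_compl by metis
    then show False using one_imp_carrier I_notcarr by blast
  qed
  have "inj_on M (Pow (Pow S))"
    by (rule inj_onI) (metis sub PowD subset_antisym)
  moreover have "M ` Pow (Pow S) \<subseteq> {P. maximal_wild_prime S R P}"
    using maximal_wild_primeI[OF M idem] by (auto simp: G_def)
  ultimately show ?thesis unfolding lepoll_def by blast
qed

theorem theorem2p18:
  fixes S :: "'i set" and R :: "'i \<Rightarrow> ('a, 'b) ring_scheme"
  assumes "infinite S"
    and "\<And>k. k \<in> S \<Longrightarrow> local_ring (R k)"
  shows "{P. maximal_wild_prime S R P} \<approx> Pow (Pow S)"
proof (rule lepoll_antisym)
  interpret local_ring_family S R
    using assms(2) by unfold_locales
  have "{P. maximal_wild_prime S R P} \<subseteq> {P. maximalideal P (product_ring S R)}"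
    by (auto simp: maximal_wild_prime_def)
  then show "{P. maximal_wild_prime S R P} \<lesssim> Pow (Pow S)"
    using maximalideals_lepoll subset_imp_lepoll lepoll_trans by blast
  show "Pow (Pow S) \<lesssim> {P. maximal_wild_prime S R P}"
    using assms(1) by (rule Pow_Pow_lepoll_maximal_wild_primes)
qed

end
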